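(* Let $q$ be a prime power, let $n\ge 2$ be an integer, and let $\Gamma$ be the singular difference graph of $M_n(\mathbb{F}_q)$. Then, for every $A\in M_n(\mathbb{F}_q)$, $$\deg(A)=q^{n^2}-\prod_{j=0}^{n-1}(q^n-q^j)-1.$$
   Context: $\mathbb{F}_q$ is the finite field with $q$ elements and $M_n(\mathbb{F}_q)$ is the vector space of all $n\times n$ matrices over $\mathbb{F}_q$. The singular difference graph $\Gamma$ of $M_n(\mathbb{F}_q)$ is the simple graph with vertex set $M_n(\mathbb{F}_q)$ in which two distinct matrices $A,B$ are adjacent if and only if $\det(A-B)=0$. The degree $\deg(A)$ of a vertex $A$ is the number of vertices adjacent to it. *)

theory Defs
  imports
    "HOL-Number_Theory.Prime_Powers"
    "Jordan_Normal_Form.Determinant"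
    "Graph_Theory.Pair_Digraph"
begin

text \<open>
  As usual in \<open>Graph_Theory\<close>, a simple graph is a loop-free symmetric digraph without multiple arcs
  (\<open>pair_graph\<close>): an undirected edge between \<open>A\<close> and \<open>B\<close> is represented
  by the two pairs \<open>(A, B)\<close> and \<open>(B, A)\<close>.
\<close>

definition singular_difference_graph :: "nat \<Rightarrow> 'a :: {field, finite} mat pair_pre_digraph" where
  "singular_difference_graph n =
    \<lparr> pverts = carrier_mat n n,
      parcs = {(A, B). A \<in> carrier_mat n n \<and> B \<in> carrier_mat n n \<and> A \<noteq> B \<and> det (A - B) = 0} \<rparr>"

definition vertex_degree :: "'v pair_pre_digraph \<Rightarrow> 'v \<Rightarrow> nat" where
  "vertex_degree G v = card {w \<in> pverts G. (v, w) \<in> parcs G}"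

lemma finite_carrier_mat: "finite (carrier_mat m n :: 'a :: finite mat set)"
proof (rule finite_subset)
  let ?F = "({..<m} \<times> {..<n}) \<rightarrow>\<^sub>E (UNIV :: 'a set)"
  show "carrier_mat m n \<subseteq> (\<lambda>f. mat m n f) ` ?F"
  proof
    fix A :: "'a mat" assume A: "A \<in> carrier_mat m n"
    show "A \<in> (\<lambda>f. mat m n f) ` ?F"
    proof (rule image_eqI)
      show "A = mat m n (restrict (\<lambda>ij. A $$ ij) ({..<m} \<times> {..<n}))"
        using A by (intro eq_matI) auto
      show "restrict (\<lambda>ij. A $$ ij) ({..<m} \<times> {..<n}) \<in> ?F"
        by (simp add: PiE_def)
    qed
  qed
  show "finite ((\<lambda>f. mat m n f) ` ?F)"
    by (intro finite_imageI finite_PiE) auto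
qed

lemma pair_graph_singular_difference_graph:
  "pair_graph (singular_difference_graph n :: 'a :: {field, finite} mat pair_pre_digraph)"
proof -
  let ?G = "singular_difference_graph n :: 'a mat pair_pre_digraph"
  have sub: "parcs ?G \<subseteq> carrier_mat n n \<times> carrier_mat n n"
    unfolding singular_difference_graph_def by auto
  have fin: "finite (parcs ?G)"
    by (rule finite_subset[OF sub]) (intro finite_cartesian_product finite_carrier_mat)
  have det0: "det (B - A) = 0" if "A \<in> carrier_mat n n" "B \<in> carrier_mat n n" "det (A - B) = 0"
    for A B :: "'a mat"
  proof -
    have "B - A = (- 1) \<cdot>\<^sub>m (A - B)"
      using that(1,2) by (intro eq_matI) auto
    then show ?thesis by (simp only: det_smult that(3) mult_zero_right)
  qed
  have sym: "symmetric ?G"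
    unfolding symmetric_def arcs_ends_def
    by (rule symI) (auto simp: singular_difference_graph_def arc_to_ends_def intro: det0)
  show ?thesis
  proof unfold_locales
    show "finite (pverts ?G)"
      by (simp add: singular_difference_graph_def finite_carrier_mat)
    show "finite (parcs ?G)" by (rule fin)
    show "symmetric ?G" by (rule sym)
  qed (auto simp: singular_difference_graph_def)
qed

lemma vertex_degree_eq_out_degree:
  assumes "pair_wf_digraph G"
  shows "vertex_degree G v = out_degree (with_proj G) v"
proof -
  interpret pair_wf_digraph G by (rule assms)
  have "w \<in> pverts G" if "(v, w) \<in> parcs G" for w
    using arc_snd_in_verts[OF that] by simp
  then have "{w \<in> pverts G. (v, w) \<in> parcs G} = {w. (v, w) \<in> parcs G}"
    by blast
  moreover have "out_arcs (with_proj G) v = Pair v ` {w. (v, w) \<in> parcs G}"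
    unfolding out_arcs_def by (auto simp: image_iff)
  ultimately show ?thesis
    by (simp add: vertex_degree_def out_degree_def card_image inj_on_def)
qed

end

theory Submission
  imports Defs "HOL-Library.Cardinality"
begin

text \<open>
  The map \<open>B \<mapsto> A - B\<close> carries the neighbours of \<open>A\<close> to the nonzero singular
  matrices, so the degree is \<open>q ^ (n ^ 2)\<close>, minus the number \<open>g n\<close> of invertible matrices,
  minus one for the zero matrix (\<open>vertex_degree_singular_difference_graph\<close>).

  The order \<open>g n\<close> of the general linear group is found by induction on \<open>n\<close>, sorting the invertible
  matrices of size \<open>n + 1\<close> by their first column \<open>v\<close>, which must be nonzero. If \<open>v\<close> has the nonzero
  coordinate \<open>k\<close>, some invertible \<open>P\<close> maps the unit vector \<open>e\<^sub>k\<close> to \<open>v\<close>, and multiplication by \<open>P\<close>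
  turns the invertible matrices with first column \<open>e\<^sub>k\<close> into those with first column \<open>v\<close>. A matrix
  with first column \<open>e\<^sub>k\<close> has, up to sign, the determinant of its minor at \<open>(k, 0)\<close>, and the other
  \<open>n\<close> entries of row \<open>k\<close> are free; hence each \<open>v\<close> is the first column of \<open>q ^ n * g n\<close> invertible
  matrices. The resulting recursion \<open>g (n + 1) = (q ^ (n + 1) - 1) * q ^ n * g n\<close> is also satisfied by
  the product in the theorem, as multiplying each of its \<open>n\<close> factors by \<open>q\<close> shifts the index.
\<close>

section \<open>Vectors and matrices over a finite type\<close>

lemma card_carrier_vec:
  "card (carrier_vec n :: 'a::finite vec set) = CARD('a) ^ n"
proof -
  have "bij_betw (vec n) ({..<n} \<rightarrow>\<^sub>E (UNIV :: 'a set)) (carrier_vec n)"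
    by (rule bij_betw_byWitness[where f' = "\<lambda>v. restrict (($) v) {..<n}"])
      (auto intro!: eq_vecI simp: fun_eq_iff PiE_def extensional_def)
  from bij_betw_same_card[OF this] show ?thesis
    by (simp add: card_PiE)
qed

lemma card_carrier_mat:
  "card (carrier_mat m n :: 'a::finite mat set) = CARD('a) ^ (m * n)"
proof -
  have "bij_betw (mat m n) (({..<m} \<times> {..<n}) \<rightarrow>\<^sub>E (UNIV :: 'a set)) (carrier_mat m n)"
    by (rule bij_betw_byWitness[where f' = "\<lambda>A. restrict (($$) A) ({..<m} \<times> {..<n})"])
      (auto intro!: eq_matI simp: fun_eq_iff PiE_def extensional_def)
  from bij_betw_same_card[OF this] show ?thesis
    by (simp add: card_PiE card_cartesian_product)
qed

section \<open>The order of the general linear group\<close>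

definition nonsingular_mats :: "nat \<Rightarrow> 'a::comm_ring_1 mat set" where
  "nonsingular_mats n = {M \<in> carrier_mat n n. det M \<noteq> 0}"

lemma finite_nonsingular_mats:
  "finite (nonsingular_mats n :: 'a::{comm_ring_1, finite} mat set)"
  unfolding nonsingular_mats_def by (simp add: finite_carrier_mat)

text \<open>Only one term of the Laplace expansion along a unit column survives.\<close>

lemma det_col_eq_unit_vec:
  fixes M :: "'a::comm_ring_1 mat"
  assumes M: "M \<in> carrier_mat n n" and k: "k < n" and j: "j < n"
    and c: "col M j = unit_vec n k"
  shows "det M = (- 1) ^ (k + j) * det (mat_delete M k j)"
proof -
  have e: "M $$ (i, j) = (if i = k then 1 else 0)" if "i < n" for i
  proof -
    have "M $$ (i, j) = col M j $ i" using M that j by simp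
    then show ?thesis using that k by (simp add: c)
  qed
  have "det M = (\<Sum>i<n. M $$ (i, j) * cofactor M i j)"
    by (rule laplace_expansion_column[OF M j])
  also have "\<dots> = (\<Sum>i<n. if i = k then cofactor M i j else 0)"
    by (rule sum.cong) (auto simp: e)
  also have "\<dots> = cofactor M k j"
    using k by simp
  finally show ?thesis by (simp add: cofactor_def)
qed

text \<open>
  The explicit inverse of the bijection reassembles a matrix from its prescribed first column, the
  rest of row \<open>k\<close>, and the minor at \<open>(k, 0)\<close>.
\<close>

lemma card_nonsingular_mats_col_unit_vec:
  assumes k: "k < Suc n"
  shows "card {M :: 'a::{comm_ring_1, finite} mat.
      M \<in> nonsingular_mats (Suc n) \<and> col M 0 = unit_vec (Suc n) k}
    = CARD('a) ^ n * card (nonsingular_mats n :: 'a mat set)"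
proof -
  let ?S = "{M \<in> nonsingular_mats (Suc n). col M 0 = unit_vec (Suc n) k} :: 'a mat set"
  let ?T = "carrier_vec n \<times> nonsingular_mats n :: ('a vec \<times> 'a mat) set"
  define split where "split M = (vec n (\<lambda>j. M $$ (k, Suc j)), mat_delete M k 0)" for M :: "'a mat"
  define join where "join = (\<lambda>(r, B). mat (Suc n) (Suc n) (\<lambda>(i, j).
    if j = 0 then (if i = k then 1 else 0)
    else if i = k then r $ (j - 1) else B $$ (if i < k then i else i - 1, j - 1)) :: 'a mat)"
  have det_iff: "det M \<noteq> 0 \<longleftrightarrow> det (mat_delete M k 0) \<noteq> 0"
    if "M \<in> carrier_mat (Suc n) (Suc n)" "col M 0 = unit_vec (Suc n) k" for M :: "'a mat"
  proof -
    have "det M = (- 1) ^ k * det (mat_delete M k 0)"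
      using det_col_eq_unit_vec[OF that(1) k _ that(2)] by simp
    then show ?thesis by (cases "even k") simp_all
  qed
  have join_split: "join (split M) = M" if M: "M \<in> ?S" for M
  proof -
    have MC: "M \<in> carrier_mat (Suc n) (Suc n)" and c: "col M 0 = unit_vec (Suc n) k"
      using M by (auto simp: nonsingular_mats_def)
    have e: "M $$ (i, 0) = (if i = k then 1 else 0)" if "i < Suc n" for i
    proof -
      have "M $$ (i, 0) = col M 0 $ i" using MC that by simp
      then show ?thesis using that k by (simp add: c)
    qed
    show ?thesis
      using MC k by (intro eq_matI) (auto simp: join_def split_def mat_delete_def e)
  qed
  have join_carrier: "join p \<in> carrier_mat (Suc n) (Suc n)" for p
    by (auto simp: join_def split: prod.splits)
  have join_col: "col (join p) 0 = unit_vec (Suc n) k" for p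
    using k by (intro eq_vecI) (auto simp: join_def split: prod.splits)
  have split_join: "split (join p) = p" if p: "p \<in> ?T" for p
  proof (cases p)
    case (Pair r B)
    then have r: "dim_vec r = n" and B: "B \<in> carrier_mat n n"
      using p by (auto simp: nonsingular_mats_def)
    have "vec n (\<lambda>j. join (r, B) $$ (k, Suc j)) = r"
      using r k by (intro eq_vecI) (auto simp: join_def)
    moreover have "mat_delete (join (r, B)) k 0 = B"
      using B k by (intro eq_matI) (auto simp: join_def mat_delete_def)
    ultimately show ?thesis by (simp add: split_def Pair)
  qed
  have "bij_betw split ?S ?T"
  proof (rule bij_betw_byWitness[where f' = join])
    show "split ` ?S \<subseteq> ?T"
      using det_iff by (auto simp: split_def nonsingular_mats_def mat_delete_def)
    show "join ` ?T \<subseteq> ?S"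
    proof safe
      fix r :: "'a vec" and B :: "'a mat"
      assume "r \<in> carrier_vec n" "B \<in> nonsingular_mats n"
      then have "mat_delete (join (r, B)) k 0 = B" "det B \<noteq> 0"
        using split_join[of "(r, B)"] by (auto simp: split_def nonsingular_mats_def)
      then show "join (r, B) \<in> nonsingular_mats (Suc n)"
        using det_iff[OF join_carrier join_col] join_carrier by (simp add: nonsingular_mats_def)
    qed (rule join_col)
  qed (use join_split split_join in blast)+
  then show ?thesis
    using bij_betw_same_card[of split ?S ?T] by (simp add: card_cartesian_product card_carrier_vec)
qed

lemma mult_mat_unit_vec:
  fixes M :: "'a::semiring_1 mat"
  assumes "M \<in> carrier_mat m n" and "k < n"
  shows "M *\<^sub>v unit_vec n k = col M k"
  using assms by (intro eq_vecI) auto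

lemma ex_nonsingular_mult_unit_vec:
  fixes v :: "'a::field vec"
  assumes v: "v \<in> carrier_vec n" and k: "k < n" and nz: "v $ k \<noteq> 0"
  obtains P where "P \<in> nonsingular_mats n" "P *\<^sub>v unit_vec n k = v"
proof
  let ?P = "replace_col (1\<^sub>m n) v k"
  have P: "?P \<in> carrier_mat n n" by (simp add: replace_col_def)
  \<comment> \<open>By Cramer's rule for the identity matrix, \<open>det ?P = v $ k\<close>.\<close>
  have "det ?P = v $ k"
    using cramer_lemma_mat[of "1\<^sub>m n" n v k] v k by simp
  then show "?P \<in> nonsingular_mats n"
    using P nz by (simp add: nonsingular_mats_def)
  show "?P *\<^sub>v unit_vec n k = v"
    using P v k mult_mat_unit_vec[OF P k]
    by (intro eq_vecI) (auto simp: replace_col_def)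
qed

text \<open>
  Left multiplication by an invertible matrix permutes the invertible matrices and acts on each of
  their columns separately, so columns in one orbit occur equally often.
\<close>

lemma card_nonsingular_mats_col_mult:
  fixes P :: "'a::field mat"
  assumes P: "P \<in> nonsingular_mats n" and j: "j < n" and w: "w \<in> carrier_vec n"
  shows "card {M \<in> nonsingular_mats n. col M j = P *\<^sub>v w}
    = card {M \<in> nonsingular_mats n. col M j = w}"
proof -
  let ?S = "\<lambda>v. {M \<in> nonsingular_mats n. col M j = v} :: 'a mat set"
  have PC: "P \<in> carrier_mat n n" and dP: "det P \<noteq> 0"
    using P by (auto simp: nonsingular_mats_def)
  obtain Q where Q: "Q \<in> carrier_mat n n" "Q * P = 1\<^sub>m n" "P * Q = 1\<^sub>m n"
    using det_non_zero_imp_unit[OF PC dP, of "()"]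
    by (auto simp: Units_def ring_mat_def)
  have "det Q * det P = 1"
    using det_mult[OF Q(1) PC] Q(2) by simp
  then have dQ: "det Q \<noteq> 0" by auto
  have QPx: "Q *\<^sub>v (P *\<^sub>v w) = w"
    using assoc_mult_mat_vec[OF Q(1) PC w] Q(2) w by simp
  have cancel: "X * (Y * M) = M"
    if "X \<in> carrier_mat n n" "Y \<in> carrier_mat n n" "X * Y = 1\<^sub>m n" "M \<in> carrier_mat n n"
    for X Y M :: "'a mat"
    using assoc_mult_mat[OF that(1,2,4)] that(3,4) by simp
  have "bij_betw ((*) P) (?S w) (?S (P *\<^sub>v w))"
  proof (rule bij_betw_byWitness[where f' = "(*) Q"])
    show "\<forall>M\<in>?S w. Q * (P * M) = M"
      using cancel[OF Q(1) PC Q(2)] by (auto simp: nonsingular_mats_def)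
    show "\<forall>M\<in>?S (P *\<^sub>v w). P * (Q * M) = M"
      using cancel[OF PC Q(1) Q(3)] by (auto simp: nonsingular_mats_def)
    show "(*) P ` ?S w \<subseteq> ?S (P *\<^sub>v w)"
      using PC dP j by (auto simp: nonsingular_mats_def det_mult simp del: col_mult)
    show "(*) Q ` ?S (P *\<^sub>v w) \<subseteq> ?S w"
      using Q(1) dQ j QPx by (auto simp: nonsingular_mats_def det_mult simp del: col_mult)
  qed
  from bij_betw_same_card[OF this] show ?thesis by simp
qed

text \<open>
  The first factor counts the possible first columns, which are all the nonzero vectors, and the
  second the invertible matrices with a given first column, a number that does not depend on the
  column because all nonzero vectors lie in one orbit.
\<close>

lemma card_nonsingular_mats_Suc:
  "card (nonsingular_mats (Suc n) :: 'a::{field, finite} mat set)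
    = (CARD('a) ^ Suc n - 1) * (CARD('a) ^ n * card (nonsingular_mats n :: 'a mat set))"
proof -
  let ?m = "Suc n"
  let ?V = "carrier_vec ?m - {0\<^sub>v ?m} :: 'a vec set"
  let ?S = "\<lambda>v. {M \<in> nonsingular_mats ?m. col M 0 = v} :: 'a mat set"
  have finV: "finite (carrier_vec ?m :: 'a vec set)"
    by (rule card_ge_0_finite) (simp add: card_carrier_vec)
  have nz: "col M 0 \<noteq> 0\<^sub>v ?m" if "M \<in> nonsingular_mats ?m" for M :: "'a mat"
  proof
    assume c: "col M 0 = 0\<^sub>v ?m"
    have M: "M \<in> carrier_mat ?m ?m" and d: "det M \<noteq> 0"
      using that by (auto simp: nonsingular_mats_def)
    have "M *\<^sub>v unit_vec ?m 0 = 0\<^sub>v ?m"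
      using mult_mat_unit_vec[OF M, of 0] c by simp
    moreover have "unit_vec ?m 0 \<noteq> (0\<^sub>v ?m :: 'a vec)"
      by simp
    ultimately show False
      using d det_0_iff_vec_prod_zero[OF M] unit_vec_carrier[of ?m 0] by blast
  qed
  have "nonsingular_mats ?m = (\<Union>v\<in>?V. ?S v)"
  proof -
    have "col M 0 \<in> ?V" if "M \<in> nonsingular_mats ?m" for M :: "'a mat"
    proof -
      have "col M 0 \<in> carrier_vec ?m"
        using that by (intro carrier_vecI) (auto simp: nonsingular_mats_def)
      then show ?thesis using nz[OF that] by blast
    qed
    then show ?thesis by blast
  qed
  then have "card (nonsingular_mats ?m :: 'a mat set) = card (\<Union>v\<in>?V. ?S v)"
    by simp
  also have "\<dots> = (\<Sum>v\<in>?V. card (?S v))"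
    using finV by (intro card_UN_disjoint) (auto simp: finite_nonsingular_mats)
  also have "\<dots> = (\<Sum>v\<in>?V. CARD('a) ^ n * card (nonsingular_mats n :: 'a mat set))"
  proof (rule sum.cong)
    fix v assume v: "v \<in> ?V"
    then have "\<exists>k<?m. v $ k \<noteq> 0"
      by (metis DiffD1 DiffD2 carrier_vecD eq_vecI index_zero_vec insertI1)
    then obtain k where k: "k < ?m" "v $ k \<noteq> 0" by blast
    obtain P where P: "P \<in> nonsingular_mats ?m" "P *\<^sub>v unit_vec ?m k = v"
      using ex_nonsingular_mult_unit_vec[of v ?m k] v k by blast
    show "card (?S v) = CARD('a) ^ n * card (nonsingular_mats n :: 'a mat set)"
      using card_nonsingular_mats_col_mult[OF P(1), of 0 "unit_vec ?m k"] P(2)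
        card_nonsingular_mats_col_unit_vec[OF k(1), where 'a = 'a] by simp
  qed simp
  also have "\<dots> = card ?V * (CARD('a) ^ n * card (nonsingular_mats n :: 'a mat set))"
    by simp
  also have "card ?V = CARD('a) ^ ?m - 1"
    by (simp add: card_carrier_vec card_Diff_singleton)
  finally show ?thesis .
qed

theorem card_nonsingular_mats:
  "int (card (nonsingular_mats n :: 'a::{field, finite} mat set))
    = (\<Prod>j<n. int CARD('a) ^ n - int CARD('a) ^ j)"
proof (induction n)
  case 0
  have "nonsingular_mats 0 = {1\<^sub>m 0 :: 'a mat}"
    by (auto simp: nonsingular_mats_def)
  then show ?case by simp
next
  case (Suc n)
  let ?q = "int CARD('a)"
  have "int (CARD('a) ^ Suc n - 1) = ?q ^ Suc n - 1"
    by (subst of_nat_diff) auto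
  then have "int (card (nonsingular_mats (Suc n) :: 'a mat set))
      = (?q ^ Suc n - 1) * (?q ^ n * (\<Prod>j<n. ?q ^ n - ?q ^ j))"
    by (simp only: card_nonsingular_mats_Suc of_nat_mult of_nat_power Suc.IH)
  also have "?q ^ n * (\<Prod>j<n. ?q ^ n - ?q ^ j) = (\<Prod>j<n. ?q ^ Suc n - ?q ^ Suc j)"
    using prod.distrib[of "\<lambda>_. ?q" "\<lambda>j. ?q ^ n - ?q ^ j" "{..<n}"]
    by (simp add: right_diff_distrib)
  finally show ?case
    by (simp only: prod.lessThan_Suc_shift power_0)
qed

section \<open>Degrees in the singular difference graph\<close>

lemma vertex_degree_singular_difference_graph:
  fixes A :: "'a::{field, finite} mat"
  assumes A: "A \<in> carrier_mat n n" and n: "n > 0"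
  shows "int (vertex_degree (singular_difference_graph n) A)
    = int CARD('a) ^ (n ^ 2) - int (card (nonsingular_mats n :: 'a mat set)) - 1"
proof -
  let ?C = "carrier_mat n n :: 'a mat set"
  let ?N = "{B \<in> ?C. A \<noteq> B \<and> det (A - B) = 0}"
  let ?Z = "?C - nonsingular_mats n - {0\<^sub>m n n}"
  have inv: "A - (A - B) = B" if "B \<in> ?C" for B
    using A that by (intro eq_matI) auto
  have diff0: "A - B = 0\<^sub>m n n \<longleftrightarrow> A = B" if "B \<in> ?C" for B
  proof
    assume "A - B = 0\<^sub>m n n"
    then have "A - 0\<^sub>m n n = B" using inv[OF that] by simp
    moreover have "A - 0\<^sub>m n n = A" using A by (intro eq_matI) auto
    ultimately show "A = B" by simp
  qed (use that in auto)
  have "bij_betw ((-) A) ?N ?Z"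
  proof (rule bij_betw_byWitness[where f' = "(-) A"])
    show "(-) A ` ?N \<subseteq> ?Z"
      using A diff0 by (auto simp: nonsingular_mats_def)
    show "(-) A ` ?Z \<subseteq> ?N"
    proof (rule image_subsetI)
      fix M assume "M \<in> ?Z"
      then have M: "M \<in> ?C" "det M = 0" "M \<noteq> 0\<^sub>m n n"
        by (auto simp: nonsingular_mats_def)
      have AM: "A - M \<in> ?C" using A M by auto
      have "A \<noteq> A - M" using diff0[OF AM] inv[OF M(1)] M(3) by simp
      then show "A - M \<in> ?N" using AM inv[OF M(1)] M(2) by simp
    qed
  qed (use inv in auto)
  then have "card ?N = card ?Z" by (rule bij_betw_same_card)
  then have "vertex_degree (singular_difference_graph n) A = card ?Z"
    using A by (simp add: vertex_degree_def singular_difference_graph_def)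
  moreover have "int (card ?Z) = int (card (?C - nonsingular_mats n)) - 1"
  proof -
    have "0\<^sub>m n n \<in> ?C - nonsingular_mats n"
      using n by (simp add: nonsingular_mats_def)
    then have "card (?C - nonsingular_mats n) = Suc (card ?Z)"
      by (intro card.remove) (simp_all add: finite_carrier_mat)
    then show ?thesis by simp
  qed
  moreover have "int (card (?C - nonsingular_mats n))
      = int (card ?C) - int (card (nonsingular_mats n :: 'a mat set))"
  proof -
    have sub: "nonsingular_mats n \<subseteq> ?C" by (auto simp: nonsingular_mats_def)
    then show ?thesis
      using card_mono[OF finite_carrier_mat sub]
      by (simp add: card_Diff_subset finite_nonsingular_mats of_nat_diff)
  qed
  ultimately show ?thesis
    by (simp add: card_carrier_mat power2_eq_square)
qed

theorem theorem4p6: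
  fixes n q :: nat and A :: "'a :: {field, finite} mat"
  assumes "primepow q"
    and "card (UNIV :: 'a set) = q"
    and "n \<ge> 2"
    and "A \<in> carrier_mat n n"
  shows "int (vertex_degree (singular_difference_graph n) A)
    = int q ^ (n ^ 2) - (\<Prod>j = 0..n - 1. int q ^ n - int q ^ j) - 1"
proof -
  have "{0..n - 1} = {..<n}"
    using assms(3) by auto
  then show ?thesis
    using vertex_degree_singular_difference_graph[OF assms(4)] assms(2,3)
    by (simp add: card_nonsingular_mats)
qed

end
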